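(* For each finite graph $\Gamma$ with $m$ vertices, there exists a finite tree $T$ with $|V(T)|\leqslant m2^{m-1}$ such that $G(\Gamma)$ admits a quasi-isometric group embedding into $G(T)$.
   Context: All graphs are undirected and simplicial. For a graph $\Gamma$, $G(\Gamma)$ is the group with generating set $V(\Gamma)$ and relations $[u,v]=1$ whenever $\{u,v\}$ is not an edge of $\Gamma$ (the right-angled Artin group on the complement graph). A quasi-isometric group embedding from a finitely generated group $G$ to a finitely generated group $H$ is an injective homomorphism $f:G\to H$ that is a quasi-isometric embedding with respect to word metrics, i.e. there is $C\ge1$ with $d(x,y)/C-C\le d(f(x),f(y))\le Cd(x,y)+C$ for all $x,y\in G$. *)

theory Defs
  imports Complex_Main "HOL-Algebra.Group"
begin

definition finite_graph :: "'a set \<Rightarrow> 'a set set \<Rightarrow> bool" where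
  "finite_graph V E \<longleftrightarrow> finite V \<and> (\<forall>e\<in>E. e \<subseteq> V \<and> card e = 2)"

definition adjacent :: "'a set set \<Rightarrow> 'a \<Rightarrow> 'a \<Rightarrow> bool" where
  "adjacent E u v \<longleftrightarrow> {u, v} \<in> E"

definition is_walk :: "'a set \<Rightarrow> 'a set set \<Rightarrow> 'a list \<Rightarrow> bool" where
  "is_walk V E p \<longleftrightarrow> p \<noteq> [] \<and> set p \<subseteq> V \<and>
     (\<forall>i. Suc i < length p \<longrightarrow> adjacent E (p ! i) (p ! Suc i))"

definition connected_graph :: "'a set \<Rightarrow> 'a set set \<Rightarrow> bool" where
  "connected_graph V E \<longleftrightarrow>
     (\<forall>u\<in>V. \<forall>v\<in>V. \<exists>p. is_walk V E p \<and> hd p = u \<and> last p = v)"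

definition is_cycle :: "'a set \<Rightarrow> 'a set set \<Rightarrow> 'a list \<Rightarrow> bool" where
  "is_cycle V E c \<longleftrightarrow> length c \<ge> 3 \<and> distinct c \<and> is_walk V E c \<and>
     adjacent E (last c) (hd c)"

definition acyclic_graph :: "'a set \<Rightarrow> 'a set set \<Rightarrow> bool" where
  "acyclic_graph V E \<longleftrightarrow> (\<nexists>c. is_cycle V E c)"

definition finite_tree :: "'a set \<Rightarrow> 'a set set \<Rightarrow> bool" where
  "finite_tree V E \<longleftrightarrow> finite_graph V E \<and> V \<noteq> {} \<and> connected_graph V E \<and> acyclic_graph V E"

section \<open>The group G(Gamma): right-angled Artin group on the complement graph\<close>

text \<open>Words over the generators V and their inverses: a letter (v, True) is v,
 a letter (v, False) is v inverse.\<close>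
definition gwords :: "'a set \<Rightarrow> ('a \<times> bool) list set" where
  "gwords V = lists (V \<times> UNIV)"

inductive gequiv :: "'a set \<Rightarrow> 'a set set \<Rightarrow> ('a \<times> bool) list \<Rightarrow> ('a \<times> bool) list \<Rightarrow> bool"
  for V E where
  refl: "w \<in> gwords V \<Longrightarrow> gequiv V E w w"
| sym: "gequiv V E w w' \<Longrightarrow> gequiv V E w' w"
| trans: "gequiv V E w w' \<Longrightarrow> gequiv V E w' w'' \<Longrightarrow> gequiv V E w w''"
| cancel: "xs \<in> gwords V \<Longrightarrow> ys \<in> gwords V \<Longrightarrow> v \<in> V \<Longrightarrow>
     gequiv V E (xs @ (v, b) # (v, \<not> b) # ys) (xs @ ys)"
| commute: "xs \<in> gwords V \<Longrightarrow> ys \<in> gwords V \<Longrightarrow> u \<in> V \<Longrightarrow> v \<in> V \<Longrightarrow> {u, v} \<notin> E \<Longrightarrow>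
     gequiv V E (xs @ (u, b) # (v, c) # ys) (xs @ (v, c) # (u, b) # ys)"

definition grel :: "'a set \<Rightarrow> 'a set set \<Rightarrow> (('a \<times> bool) list \<times> ('a \<times> bool) list) set" where
  "grel V E = {(w, w'). gequiv V E w w'}"

definition gclass :: "'a set \<Rightarrow> 'a set set \<Rightarrow> ('a \<times> bool) list \<Rightarrow> ('a \<times> bool) list set" where
  "gclass V E w = grel V E `` {w}"

definition G :: "'a set \<Rightarrow> 'a set set \<Rightarrow> (('a \<times> bool) list set) monoid" where
  "G V E = \<lparr> carrier = gwords V // grel V E,
             monoid.mult = (\<lambda>X Y. gclass V E ((SOME x. x \<in> X) @ (SOME y. y \<in> Y))),
             one = gclass V E [] \<rparr>"

definition word_dist :: "'a set \<Rightarrow> 'a set set \<Rightarrow> ('a \<times> bool) list set \<Rightarrow> ('a \<times> bool) list set \<Rightarrow> nat" where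
  "word_dist V E x y = (LEAST n. \<exists>w \<in> gwords V. length w = n \<and> x \<otimes>\<^bsub>G V E\<^esub> gclass V E w = y)"

definition qi_group_embedding ::
  "'a set \<Rightarrow> 'a set set \<Rightarrow> 'b set \<Rightarrow> 'b set set \<Rightarrow>
   (('a \<times> bool) list set \<Rightarrow> ('b \<times> bool) list set) \<Rightarrow> bool" where
  "qi_group_embedding V E V' E' f \<longleftrightarrow>
     f \<in> hom (G V E) (G V' E') \<and> inj_on f (carrier (G V E)) \<and>
     (\<exists>C::real. C \<ge> 1 \<and> (\<forall>x \<in> carrier (G V E). \<forall>y \<in> carrier (G V E).
        real (word_dist V E x y) / C - C \<le> real (word_dist V' E' (f x) (f y)) \<and>
        real (word_dist V' E' (f x) (f y)) \<le> C * real (word_dist V E x y) + C))"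

end

theory Submission
  imports Defs "HOL-Library.Sublist"
begin

text \<open>For \<open>v \<in> V\<close> let \<open>T(S, v)\<close> be the tree whose root has label \<open>v\<close> and, for the neighbours
  \<open>u\<^sub>1, u\<^sub>2, \<dots>\<close> of \<open>v\<close> in \<open>S\<close>, has the subtrees
  \<open>T(S - {v}, u\<^sub>1)\<close>, \<open>T(S - {v, u\<^sub>1}, u\<^sub>2)\<close>, \<open>\<dots>\<close>; it has at most \<open>2 ^ (card S - 1)\<close> vertices.
  Send a generator to the product of all tree vertices that carry its label. In the image of a
  reduced word over \<open>S\<close> no letter of the root can cancel: between two root letters that cancel,
  the image of the enclosed word would commute with the root, hence would equal a word
  without letters at the child roots, and by induction on \<open>S\<close> the enclosed word would contain
  none of \<open>u\<^sub>1, u\<^sub>2, \<dots>\<close>, so that the word would not be reduced. With one such tree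
  \<open>T(V, v)\<close> for every \<open>v\<close>, the image of a reduced word has at least its length.

  To join the \<open>m\<close> trees within \<open>m 2 ^ (m - 1)\<close> vertices, use a vertex \<open>a\<close> adjacent to all others
  as a common parent in place of the tree \<open>T(V, a)\<close>; if there is no such vertex, each
  \<open>T(V, v)\<close> has fewer than \<open>2 ^ (m - 1)\<close> vertices and there is room for an unlabelled centre.\<close>

section \<open>Words\<close>

lemma gwords_simps [simp]:
  "[] \<in> gwords V"
  "l # w \<in> gwords V \<longleftrightarrow> fst l \<in> V \<and> w \<in> gwords V"
  "u @ w \<in> gwords V \<longleftrightarrow> u \<in> gwords V \<and> w \<in> gwords V"
  by (cases l; auto simp: gwords_def)+

lemma gwords_iff: "w \<in> gwords V \<longleftrightarrow> fst ` set w \<subseteq> V"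
  by (induction w) auto

lemma gequiv_gwords: "gequiv V E w w' \<Longrightarrow> w \<in> gwords V \<and> w' \<in> gwords V"
  by (induction rule: gequiv.induct) auto

lemmas gequiv_trans [trans] = gequiv.trans

lemma gequiv_append_left:
  assumes "gequiv V E w w'" "u \<in> gwords V"
  shows "gequiv V E (u @ w) (u @ w')"
  using assms
proof (induction rule: gequiv.induct)
  case (refl w) then show ?case by (intro gequiv.refl) simp
next
  case (sym w w') then show ?case by (blast intro: gequiv.sym)
next
  case (trans w w' w'') then show ?case by (blast intro: gequiv.trans)
next
  case (cancel xs ys v b)
  then show ?case using gequiv.cancel[of "u @ xs" V ys v E b] by simp
next
  case (commute xs ys a v b c)
  then show ?case using gequiv.commute[of "u @ xs" V ys a v E b c] by simp
qed

lemma gequiv_append_right: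
  assumes "gequiv V E w w'" "u \<in> gwords V"
  shows "gequiv V E (w @ u) (w' @ u)"
  using assms
proof (induction rule: gequiv.induct)
  case (refl w) then show ?case by (intro gequiv.refl) simp
next
  case (sym w w') then show ?case by (blast intro: gequiv.sym)
next
  case (trans w w' w'') then show ?case by (blast intro: gequiv.trans)
next
  case (cancel xs ys v b)
  then show ?case using gequiv.cancel[of xs V "ys @ u" v E b] by simp
next
  case (commute xs ys a v b c)
  then show ?case using gequiv.commute[of xs V "ys @ u" a v E b c] by simp
qed

lemma gequiv_append:
  assumes "gequiv V E u u'" "gequiv V E w w'"
  shows "gequiv V E (u @ w) (u' @ w')"
  using gequiv.trans[OF gequiv_append_right[OF assms(1)] gequiv_append_left[OF assms(2)]]
    gequiv_gwords[OF assms(1)] gequiv_gwords[OF assms(2)] by blast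

text \<open>Under deletion of all letters outside \<open>R\<close> each relation becomes a relation
  or trivial: this is the retraction onto the subgroup generated by \<open>R\<close>. It later
  restricts a lift to one subtree.\<close>

lemma gequiv_filter:
  assumes "gequiv V E w w'"
  shows "gequiv V E (filter (\<lambda>l. fst l \<in> R) w) (filter (\<lambda>l. fst l \<in> R) w')"
proof -
  have words: "filter P u \<in> gwords V" if "u \<in> gwords V" for P u
    using that by (auto simp: gwords_def)
  from assms show ?thesis
  proof (induction rule: gequiv.induct)
    case (refl w) then show ?case by (intro gequiv.refl words)
  next
    case (sym w w') then show ?case by (blast intro: gequiv.sym)
  next
    case (trans w w' w'') then show ?case by (blast intro: gequiv.trans)
  next
    case (cancel xs ys v b)
    then show ?case by (auto intro!: gequiv.cancel gequiv.refl words)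
  next
    case (commute xs ys a v b c)
    then show ?case by (auto intro!: gequiv.commute gequiv.refl words)
  qed
qed

definition winv :: "('a \<times> bool) list \<Rightarrow> ('a \<times> bool) list" where
  "winv w = rev (map (\<lambda>l. (fst l, \<not> snd l)) w)"

lemma winv_gwords [simp]: "winv w \<in> gwords V \<longleftrightarrow> w \<in> gwords V"
  by (simp add: winv_def gwords_iff image_image)

lemma winv_winv [simp]: "winv (winv w) = w"
  by (simp add: winv_def rev_map comp_def)

lemma gequiv_winv_right: "w \<in> gwords V \<Longrightarrow> gequiv V E (w @ winv w) []"
proof (induction w)
  case (Cons l w)
  have "gequiv V E ([l] @ (w @ winv w) @ winv [l]) ([l] @ [] @ winv [l])"
    using Cons by (intro gequiv_append_left gequiv_append_right) (auto simp: winv_def)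
  also have "gequiv V E ([l] @ [] @ winv [l]) []"
    using gequiv.cancel[of "[]" V "[]" "fst l" E "snd l"] Cons.prems by (simp add: winv_def)
  finally show ?case by (simp add: winv_def)
qed (simp add: winv_def gequiv.refl)

lemma gequiv_winv_left: "w \<in> gwords V \<Longrightarrow> gequiv V E (winv w @ w) []"
  using gequiv_winv_right[of "winv w" V E] by simp

lemma gequiv_left_cancel:
  assumes "gequiv V E (u @ w) (u @ w')"
  shows "gequiv V E w w'"
proof -
  have words: "u \<in> gwords V" "w \<in> gwords V" "w' \<in> gwords V"
    using gequiv_gwords[OF assms] by auto
  have collapse: "gequiv V E (winv u @ u @ z) z" if "z \<in> gwords V" for z
    using gequiv_append_right[OF gequiv_winv_left[OF words(1), of E] that] by simp
  have "gequiv V E w (winv u @ u @ w)" by (rule gequiv.sym[OF collapse[OF words(2)]])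
  also have "gequiv V E (winv u @ u @ w) (winv u @ u @ w')"
    using assms words by (intro gequiv_append_left[where u = "winv u"]) auto
  also have "gequiv V E (winv u @ u @ w') w'" by (rule collapse[OF words(3)])
  finally show ?thesis .
qed

lemma gequiv_commute_letter:
  assumes "v \<in> V" "w \<in> gwords V" "\<And>l. l \<in> set w \<Longrightarrow> {v, fst l} \<notin> E"
  shows "gequiv V E ((v, b) # w) (w @ [(v, b)])"
  using assms
proof (induction w)
  case (Cons l w)
  have "gequiv V E ((v, b) # l # w) (l # (v, b) # w)"
    using gequiv.commute[of "[]" V w v "fst l" E b "snd l"] Cons.prems by simp
  also have "gequiv V E (l # (v, b) # w) (l # w @ [(v, b)])"
    using gequiv_append_left[of V E _ _ "[l]"] Cons by simp
  finally show ?case by simp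
qed (simp add: gequiv.refl)

lemma gequiv_commute_words:
  assumes "u \<in> gwords V" "w \<in> gwords V"
    and "\<And>l l'. l \<in> set u \<Longrightarrow> l' \<in> set w \<Longrightarrow> {fst l, fst l'} \<notin> E"
  shows "gequiv V E (u @ w) (w @ u)"
  using assms
proof (induction u)
  case (Cons l u)
  have "gequiv V E ([l] @ u @ w) ([l] @ w @ u)"
    using Cons by (intro gequiv_append_left) auto
  also have "gequiv V E ([l] @ w @ u) (w @ l # u)"
    using gequiv_append_right[OF gequiv_commute_letter[of "fst l" V w E "snd l"], of u] Cons.prems
    by simp
  finally show ?case by simp
qed (simp add: gequiv.refl)

section \<open>Letter counts and reduced words\<close>

definition occ :: "'a \<Rightarrow> ('a \<times> bool) list \<Rightarrow> nat" where
  "occ x w = length (filter (\<lambda>l. fst l = x) w)"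

lemma occ_simps [simp]:
  "occ x [] = 0"
  "occ x (l # w) = (if fst l = x then Suc (occ x w) else occ x w)"
  "occ x (u @ w) = occ x u + occ x w"
  by (auto simp: occ_def)

lemma occ_eq_0_iff: "occ x w = 0 \<longleftrightarrow> x \<notin> fst ` set w"
  by (induction w) auto

lemma occ_filter_le: "occ x (filter P w) \<le> occ x w"
  by (induction w) auto

lemma sum_occ:
  assumes "finite V" "w \<in> gwords V"
  shows "(\<Sum>v\<in>V. occ v w) = length w"
  using assms(2)
proof (induction w)
  case (Cons l w)
  have "(\<Sum>v\<in>V. occ v (l # w)) = (\<Sum>v\<in>V. (if fst l = v then 1 else 0) + occ v w)"
    by (intro sum.cong) auto
  then show ?case using Cons assms(1) by (simp add: sum.distrib)
qed simp

lemma sum_occ_le: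
  assumes "finite V" shows "(\<Sum>v\<in>V. occ v w) \<le> length w"
proof (induction w)
  case (Cons l w)
  have "(\<Sum>v\<in>V. occ v (l # w)) = (\<Sum>v\<in>V. (if fst l = v then 1 else 0) + occ v w)"
    by (intro sum.cong) auto
  then show ?case using Cons assms(1) by (simp add: sum.distrib)
qed simp

text \<open>Minimality in the whole class, not just absence of visible cancellations: such words are
  geodesic and realise \<open>word_dist\<close>.\<close>

definition reduced :: "'a set \<Rightarrow> 'a set set \<Rightarrow> ('a \<times> bool) list \<Rightarrow> bool" where
  "reduced V E w \<longleftrightarrow> w \<in> gwords V \<and> (\<forall>w'. gequiv V E w w' \<longrightarrow> length w \<le> length w')"

lemma reduced_infix:
  assumes "reduced V E (u @ w @ z)"
  shows "reduced V E w"
  unfolding reduced_def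
proof (intro conjI allI impI)
  have words: "u \<in> gwords V" "w \<in> gwords V" "z \<in> gwords V"
    using assms by (auto simp: reduced_def)
  show "w \<in> gwords V" by fact
  fix w' assume "gequiv V E w w'"
  then have "gequiv V E (u @ w @ z) (u @ w' @ z)"
    using words by (intro gequiv_append_left gequiv_append_right)
  then show "length w \<le> length w'" using assms unfolding reduced_def by fastforce
qed

text \<open>Otherwise \<open>(v, b)\<close> slides across \<open>w\<close> and cancels its inverse,
  which leaves an equivalent word shorter by two letters.\<close>

lemma reduced_no_pinch:
  assumes "reduced V E (u @ (v, b) # w @ (v, \<not> b) # z)"
  shows "\<exists>l\<in>set w. {v, fst l} \<in> E"
proof (rule ccontr)
  assume comm: "\<not> ?thesis"
  have words: "u \<in> gwords V" "w \<in> gwords V" "z \<in> gwords V" "v \<in> V"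
    using assms by (auto simp: reduced_def)
  have "gequiv V E (u @ ((v, b) # w) @ (v, \<not> b) # z) (u @ (w @ [(v, b)]) @ (v, \<not> b) # z)"
    using comm words by (intro gequiv_append_left gequiv_append_right gequiv_commute_letter) auto
  also have "gequiv V E (u @ (w @ [(v, b)]) @ (v, \<not> b) # z) ((u @ w) @ z)"
    using gequiv.cancel[of "u @ w" V z v E b] words by simp
  finally show False using assms unfolding reduced_def by fastforce
qed

section \<open>The trace of a generator\<close>

fun push :: "'c \<times> bool \<Rightarrow> ('c \<times> bool) list \<Rightarrow> ('c \<times> bool) list" where
  "push a [] = [a]"
| "push a (t # s) = (if t = (fst a, \<not> snd a) then s else a # t # s)"

definition free_red :: "('c \<times> bool) list \<Rightarrow> ('c \<times> bool) list" where
  "free_red w = foldr push w []"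

abbreviation freely_reduced :: "('c \<times> bool) list \<Rightarrow> bool" where
  "freely_reduced \<equiv> successively (\<lambda>a t. t \<noteq> (fst a, \<not> snd a))"

text \<open>Opposite letters act on freely reduced words as mutually inverse permutations (van der
  Waerden's argument); hence \<open>free_red\<close> does not see cancelling pairs.\<close>

lemma push_inverse:
  assumes "freely_reduced s"
  shows "push (c, b) (push (c, \<not> b) s) = s"
  using assms by (cases s rule: remdups_adj.cases) (auto simp: prod_eq_iff)

lemma freely_reduced_push: "freely_reduced s \<Longrightarrow> freely_reduced (push a s)"
  by (cases s rule: remdups_adj.cases) (auto simp: successively_Cons)

lemma freely_reduced_free_red: "freely_reduced (free_red w)"
  unfolding free_red_def by (induction w) (auto simp: freely_reduced_push)

lemma free_red_cancel:
  assumes "b' \<noteq> b"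
  shows "free_red (u @ (c, b) # (c, b') # w) = free_red (u @ w)"
proof -
  from assms have "b' = (\<not> b)" by auto
  then show ?thesis
    using push_inverse[OF freely_reduced_free_red[of w]] by (simp add: free_red_def)
qed

lemma length_free_red: "length (free_red w) \<le> length w"
proof (induction w)
  case (Cons a w)
  have "length (push a s) \<le> Suc (length s)" for s by (cases s) auto
  then show ?case using Cons le_trans by (fastforce simp: free_red_def)
qed (simp add: free_red_def)

lemma free_red_id: "freely_reduced w \<Longrightarrow> free_red w = w"
proof (induction w)
  case (Cons a w)
  then show ?case by (cases w) (auto simp: free_red_def)
qed (simp add: free_red_def)

text \<open>Killing \<open>x\<close> retracts \<open>G(\<Lambda>)\<close> onto \<open>H = G(\<Lambda> - x)\<close>. Its kernel is free on the conjugates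
  of \<open>x\<close> by the cosets of the subgroup \<open>K\<close> generated by the vertices that commute with \<open>x\<close>.
  The trace records the kernel part of a word, as a word in this free basis.\<close>

definition commutants :: "'a set \<Rightarrow> 'a set set \<Rightarrow> 'a \<Rightarrow> 'a set" where
  "commutants V E x = {y \<in> V. y \<noteq> x \<and> {x, y} \<notin> E}"

definition kcoset :: "'a set \<Rightarrow> 'a set set \<Rightarrow> 'a \<Rightarrow> ('a \<times> bool) list \<Rightarrow> ('a \<times> bool) list set" where
  "kcoset V E x h = {q. \<exists>k\<in>gwords (commutants V E x). gequiv V E (h @ k) q}"

text \<open>\<open>h\<close> collects the letters other than \<open>x\<close> read so far. A letter
  \<open>x\<close> then stands for its conjugate by \<open>h\<close>, which depends only on the
  coset \<open>h K\<close>.\<close>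

fun trace :: "'a set \<Rightarrow> 'a set set \<Rightarrow> 'a \<Rightarrow> ('a \<times> bool) list \<Rightarrow> ('a \<times> bool) list \<Rightarrow>
    (('a \<times> bool) list set \<times> bool) list" where
  "trace V E x h [] = []"
| "trace V E x h (l # w) =
    (if fst l = x then (kcoset V E x h, snd l) # trace V E x h w else trace V E x (h @ [l]) w)"

lemma length_trace: "length (trace V E x h w) = occ x w"
  by (induction w arbitrary: h) auto

lemma trace_append:
  "trace V E x h (u @ w) = trace V E x h u @ trace V E x (h @ filter (\<lambda>l. fst l \<noteq> x) u) w"
  by (induction u arbitrary: h) auto

lemma commutants_gwords: "w \<in> gwords (commutants V E x) \<Longrightarrow> w \<in> gwords V"
  by (auto simp: gwords_iff commutants_def)

lemma kcoset_cong:
  assumes "gequiv V E h h'"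
  shows "kcoset V E x h = kcoset V E x h'"
proof -
  have "gequiv V E (h @ k) q \<longleftrightarrow> gequiv V E (h' @ k) q"
    if "k \<in> gwords (commutants V E x)" for k q
    using gequiv_append_right[OF assms commutants_gwords[OF that]] gequiv.trans[of V E]
      gequiv.sym[of V E] by blast
  then show ?thesis unfolding kcoset_def by blast
qed

text \<open>The letter, or its inverse for the converse inclusion, moves into the factor from
  \<open>K\<close>. Hence swapping \<open>x\<close> with a commuting letter does not change the
  coset recorded for \<open>x\<close>.\<close>

lemma kcoset_absorb:
  assumes "h \<in> gwords V" "fst l \<in> commutants V E x"
  shows "kcoset V E x (h @ [l]) = kcoset V E x h"
proof (intro equalityI subsetI)
  fix q assume "q \<in> kcoset V E x (h @ [l])"
  then show "q \<in> kcoset V E x h"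
    using assms(2) by (force simp: kcoset_def intro: bexI[where x = "l # _"])
next
  fix q assume "q \<in> kcoset V E x h"
  then obtain k where k: "k \<in> gwords (commutants V E x)" "gequiv V E (h @ k) q"
    by (auto simp: kcoset_def)
  let ?m = "(fst l, \<not> snd l)"
  have "gequiv V E (h @ l # ?m # k) (h @ k)"
    using gequiv.cancel[of h V k "fst l" E "snd l"] assms k(1) commutants_gwords[OF k(1)]
    by (simp add: commutants_def)
  with k(2) have "gequiv V E ((h @ [l]) @ ?m # k) q"
    using gequiv.trans by fastforce
  then show "q \<in> kcoset V E x (h @ [l])"
    unfolding kcoset_def using k(1) assms(2) by (intro CollectI bexI[of _ "?m # k"]) auto
qed

lemma kcoset_eqD:
  assumes "kcoset V E x h = kcoset V E x (h @ w)" "h \<in> gwords V" "w \<in> gwords V"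
  shows "\<exists>k\<in>gwords (commutants V E x). gequiv V E w k"
proof -
  have "h @ w \<in> kcoset V E x (h @ w)"
    unfolding kcoset_def using assms by (intro CollectI bexI[of _ "[]"]) (auto intro: gequiv.refl)
  then obtain k where k: "k \<in> gwords (commutants V E x)" "gequiv V E (h @ k) (h @ w)"
    unfolding assms(1)[symmetric] by (auto simp: kcoset_def)
  then show ?thesis using gequiv_left_cancel[OF gequiv.sym[OF k(2)]] by blast
qed

lemma trace_cong:
  assumes "gequiv V E h h'" "w \<in> gwords V"
  shows "trace V E x h w = trace V E x h' w"
  using assms
proof (induction w arbitrary: h h')
  case (Cons l w)
  then have "gequiv V E (h @ [l]) (h' @ [l])" by (intro gequiv_append_right) auto
  with Cons.IH[OF this] Cons.IH[OF Cons.prems(1)] Cons.prems kcoset_cong[OF Cons.prems(1), of x]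
  show ?case by simp
qed simp

text \<open>A pair of inverse letters \<open>x\<close> gives a pair of inverse letters in the trace.
  A relation among other letters keeps the class of every later prefix, and a swap with
  \<open>x\<close> changes a prefix by an element of \<open>K\<close>.\<close>

lemma free_red_trace_invariant:
  assumes "gequiv V E w w'"
  shows "free_red (trace V E x [] w) = free_red (trace V E x [] w')"
  using assms
proof (induction rule: gequiv.induct)
  case (cancel xs ys v b)
  define h where "h = filter (\<lambda>l. fst l \<noteq> x) xs"
  have h: "h \<in> gwords V" using cancel by (auto simp: h_def gwords_iff)
  show ?case
  proof (cases "v = x")
    case True
    then show ?thesis by (simp add: trace_append free_red_cancel)
  next
    case False
    have "gequiv V E (h @ [(v, b), (v, \<not> b)]) (h @ [])"
      using gequiv.cancel[of h V "[]" v E b] cancel h by simp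
    then have "trace V E x (h @ [(v, b), (v, \<not> b)]) ys = trace V E x h ys"
      using trace_cong[of V E _ _ ys x] cancel by (metis append_Nil2)
    then show ?thesis using False by (simp add: trace_append h_def)
  qed
next
  case (commute xs ys u v b c)
  define h where "h = filter (\<lambda>l. fst l \<noteq> x) xs"
  have h: "h \<in> gwords V" using commute by (auto simp: h_def gwords_iff)
  have swap: "{v, u} \<notin> E" using commute by (simp add: insert_commute)
  consider "u = x" "v = x" | "u = x" "v \<noteq> x" | "u \<noteq> x" "v = x" | "u \<noteq> x" "v \<noteq> x" by blast
  then show ?case
  proof cases
    \<comment> \<open>\<open>gequiv.commute\<close> also allows \<open>u = v\<close>: with equal
      signs both sides coincide, with opposite signs both pairs cancel.\<close>
    case 1
    then show ?thesis
      by (cases "c = b") (simp_all add: trace_append free_red_cancel)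
  next
    case 2
    then have "kcoset V E x (h @ [(v, c)]) = kcoset V E x h"
      using kcoset_absorb[OF h, of "(v, c)"] commute by (simp add: commutants_def)
    then show ?thesis using 2 by (simp add: trace_append h_def)
  next
    case 3
    then have "kcoset V E x (h @ [(u, b)]) = kcoset V E x h"
      using kcoset_absorb[OF h, of "(u, b)"] commute swap by (simp add: commutants_def)
    then show ?thesis using 3 by (simp add: trace_append h_def)
  next
    case 4
    have "gequiv V E (h @ [(u, b), (v, c)]) (h @ [(v, c), (u, b)])"
      using gequiv.commute[of h V "[]" u v E b c] commute h by simp
    then have "trace V E x (h @ [(u, b), (v, c)]) ys = trace V E x (h @ [(v, c), (u, b)]) ys"
      by (rule trace_cong) (rule commute)
    then show ?thesis using 4 by (simp add: trace_append h_def)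
  qed
qed auto

lemma trace_hd:
  assumes "trace V E x h w = a # s"
  shows "\<exists>u z. w = u @ (x, snd a) # z \<and> occ x u = 0 \<and> fst a = kcoset V E x (h @ u)"
  using assms
proof (induction w arbitrary: h)
  case (Cons l w)
  show ?case
  proof (cases "fst l = x")
    case True
    then show ?thesis using Cons.prems by (intro exI[of _ "[]"] exI[of _ w]) (auto simp: prod_eq_iff)
  next
    case False
    then obtain u z where "w = u @ (x, snd a) # z" "occ x u = 0" "fst a = kcoset V E x ((h @ [l]) @ u)"
      using Cons.IH[of "h @ [l]"] Cons.prems by auto
    then show ?thesis using False by (intro exI[of _ "l # u"] exI[of _ z]) auto
  qed
qed simp

text \<open>Cancelling neighbours of the trace come from consecutive letters \<open>x\<close> of
  \<open>w\<close>; \<open>g\<close> is the prefix that determines the coset at the first of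
  them.\<close>

lemma trace_not_freely_reduced:
  assumes "\<not> freely_reduced (trace V E x h w)"
  shows "\<exists>y b u z g. w = y @ (x, b) # u @ (x, \<not> b) # z \<and> occ x u = 0 \<and>
    g = h @ filter (\<lambda>l. fst l \<noteq> x) y \<and> kcoset V E x g = kcoset V E x (g @ u)"
  using assms
proof (induction w arbitrary: h)
  case (Cons l w)
  show ?case
  proof (cases "fst l = x \<and> freely_reduced (trace V E x h w)")
    case True
    then obtain a s where a: "trace V E x h w = a # s" "a = (kcoset V E x h, \<not> snd l)"
      using Cons.prems by (auto simp: successively_Cons neq_Nil_conv split: if_splits)
    from trace_hd[OF a(1)] a(2) obtain u z where
      "w = u @ (x, \<not> snd l) # z" "occ x u = 0" "kcoset V E x h = kcoset V E x (h @ u)"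
      by auto
    then show ?thesis using True
      by (intro exI[of _ "[]"] exI[of _ "snd l"] exI[of _ u] exI[of _ z] exI[of _ h])
        (auto simp: prod_eq_iff)
  next
    case False
    define h' where "h' = (if fst l = x then h else h @ [l])"
    have "\<not> freely_reduced (trace V E x h' w)"
      using Cons.prems False by (auto simp: h'_def)
    from Cons.IH[OF this] obtain y b u z g where *:
      "w = y @ (x, b) # u @ (x, \<not> b) # z" "occ x u = 0"
      "g = h' @ filter (\<lambda>l. fst l \<noteq> x) y" "kcoset V E x g = kcoset V E x (g @ u)" by blast
    have "g = h @ filter (\<lambda>l. fst l \<noteq> x) (l # y)" using *(3) by (simp add: h'_def)
    with * show ?thesis
      by (intro exI[of _ "l # y"] exI[of _ b] exI[of _ u] exI[of _ z] exI[of _ g]) simp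
  qed
qed simp

text \<open>The trace of \<open>w\<close> has one letter for each \<open>x\<close> in
  \<open>w\<close>. Were it freely reduced, no word equivalent to \<open>w\<close> could have a
  shorter trace. So two letters cancel, and equality of their cosets says that the enclosed word
  lies in \<open>K\<close>.\<close>

lemma fewer_occurrences_imp_pinch:
  assumes "gequiv V E w w'" "occ x w' < occ x w"
  shows "\<exists>y b u z. w = y @ (x, b) # u @ (x, \<not> b) # z \<and> occ x u = 0 \<and>
    (\<exists>k\<in>gwords (commutants V E x). gequiv V E u k)"
proof -
  have "\<not> freely_reduced (trace V E x [] w)"
  proof
    assume "freely_reduced (trace V E x [] w)"
    from free_red_id[OF this] have "occ x w = length (free_red (trace V E x [] w'))"
      using free_red_trace_invariant[OF assms(1), of x] length_trace[of V E x "[]" w] by simp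
    also have "\<dots> \<le> occ x w'"
      using length_free_red[of "trace V E x [] w'"] by (simp add: length_trace)
    finally show False using assms(2) by simp
  qed
  from trace_not_freely_reduced[OF this] obtain y b u z g where *:
    "w = y @ (x, b) # u @ (x, \<not> b) # z" "occ x u = 0"
    "g = filter (\<lambda>l. fst l \<noteq> x) y" "kcoset V E x g = kcoset V E x (g @ u)" by auto
  have "g \<in> gwords V" "u \<in> gwords V"
    using gequiv_gwords[OF assms(1)] * by (auto simp: gwords_iff)
  from kcoset_eqD[OF *(4) this] show ?thesis using *(1,2) by blast
qed

section \<open>Sending a generator to the product of its lifts\<close>

text \<open>The lifts of one letter keep the order of \<open>N\<close> for both signs. This respects
  inverses as long as lifts with the same label are not adjacent.\<close>

definition lift :: "'b list \<Rightarrow> ('b \<Rightarrow> 'a option) \<Rightarrow> ('a \<times> bool) list \<Rightarrow> ('b \<times> bool) list" where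
  "lift N lab w =
    concat (map (\<lambda>l. map (\<lambda>q. (q, snd l)) (filter (\<lambda>q. lab q = Some (fst l)) N)) w)"

lemma lift_append: "lift N lab (u @ w) = lift N lab u @ lift N lab w"
  by (simp add: lift_def)

lemma lift_gwords: "set N \<subseteq> V \<Longrightarrow> lift N lab w \<in> gwords V"
  by (auto simp: lift_def gwords_iff)

lemma length_lift: "length (lift N lab w) \<le> length N * length w"
proof (induction w)
  case (Cons l w)
  have "length (filter (\<lambda>q. lab q = Some (fst l)) N) \<le> length N" by simp
  with Cons show ?case by (simp add: lift_def add_mono)
qed (simp add: lift_def)

lemma filter_lift:
  "filter (\<lambda>l. fst l \<in> R) (lift N lab w) = lift (filter (\<lambda>q. q \<in> R) N) lab w"
  by (induction w) (auto simp: lift_def filter_map comp_def conj_commute)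

lemma lift_cong:
  assumes "\<And>l. l \<in> set w \<Longrightarrow>
    filter (\<lambda>q. lab q = Some (fst l)) N = filter (\<lambda>q. lab q = Some (fst l)) N'"
  shows "lift N lab w = lift N' lab w"
  unfolding lift_def using assms by (intro arg_cong[of _ _ concat] map_cong) auto

lemma gequiv_cancel_map:
  assumes "set M \<subseteq> V" "\<And>p q. p \<in> set M \<Longrightarrow> q \<in> set M \<Longrightarrow> {p, q} \<notin> E"
  shows "gequiv V E (map (\<lambda>q. (q, b)) M @ map (\<lambda>q. (q, \<not> b)) M) []"
  using assms
proof (induction M)
  case (Cons x M)
  let ?A = "map (\<lambda>q. (q, b)) M" and ?B = "map (\<lambda>q. (q, \<not> b)) M"
  have words: "?A \<in> gwords V" "?B \<in> gwords V" "x \<in> V"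
    using Cons.prems by (auto simp: gwords_iff)
  have "gequiv V E (((x, b) # ?A) @ (x, \<not> b) # ?B) ((?A @ [(x, b)]) @ (x, \<not> b) # ?B)"
    using words Cons.prems by (intro gequiv_append_right gequiv_commute_letter) auto
  also have "gequiv V E ((?A @ [(x, b)]) @ (x, \<not> b) # ?B) (?A @ ?B)"
    using gequiv.cancel[of ?A V ?B x E b] words by simp
  also have "gequiv V E (?A @ ?B) []"
    using Cons by auto
  finally show ?case by simp
qed (simp add: gequiv.refl)

text \<open>\<open>adj\<close> makes the labelling a graph homomorphism where it is defined, so
  lifts of nonadjacent generators are nonadjacent. The absence of loops covers two lifts of one
  generator.\<close>

lemma gequiv_lift:
  assumes "gequiv V E w w'" "set N = V'" "\<And>v. {v} \<notin> E"
    and adj: "\<And>p q a b. {p, q} \<in> E' \<Longrightarrow> lab p = Some a \<Longrightarrow> lab q = Some b \<Longrightarrow> {a, b} \<in> E"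
  shows "gequiv V' E' (lift N lab w) (lift N lab w')"
  using assms(1)
proof (induction rule: gequiv.induct)
  case (refl w)
  show ?case using assms(2) by (intro gequiv.refl lift_gwords) auto
next
  case (sym w w') then show ?case by (blast intro: gequiv.sym)
next
  case (trans w w' w'') then show ?case by (blast intro: gequiv.trans)
next
  case (cancel xs ys v b)
  let ?M = "filter (\<lambda>q. lab q = Some v) N"
  have "{p, q} \<notin> E'" if "p \<in> set ?M" "q \<in> set ?M" for p q
    using adj[of p q v v] assms(3)[of v] that by auto
  then have "gequiv V' E' (lift N lab [(v, b), (v, \<not> b)]) []"
    using gequiv_cancel_map[of ?M V' E' b] assms(2) by (auto simp: lift_def)
  then have "gequiv V' E' (lift N lab xs @ lift N lab [(v, b), (v, \<not> b)] @ lift N lab ys)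
      (lift N lab xs @ [] @ lift N lab ys)"
    using assms(2) by (intro gequiv_append_left gequiv_append_right lift_gwords) auto
  then show ?case
    using lift_append[of N lab xs "[(v, b), (v, \<not> b)] @ ys"]
      lift_append[of N lab "[(v, b), (v, \<not> b)]" ys] by (simp add: lift_append)
next
  case (commute xs ys u v b c)
  have "{fst l, fst l'} \<notin> E'"
    if "l \<in> set (lift N lab [(u, b)])" "l' \<in> set (lift N lab [(v, c)])" for l l'
    using adj[of "fst l" "fst l'" u v] commute(5) that by (auto simp: lift_def)
  then have "gequiv V' E' (lift N lab [(u, b)] @ lift N lab [(v, c)])
      (lift N lab [(v, c)] @ lift N lab [(u, b)])"
    using assms(2) by (intro gequiv_commute_words lift_gwords) auto
  then have "gequiv V' E'
      (lift N lab xs @ (lift N lab [(u, b)] @ lift N lab [(v, c)]) @ lift N lab ys)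
      (lift N lab xs @ (lift N lab [(v, c)] @ lift N lab [(u, b)]) @ lift N lab ys)"
    using assms(2) by (intro gequiv_append_left gequiv_append_right lift_gwords) auto
  then show ?case
    by (simp flip: lift_append)
qed

text \<open>In a lift, a letter that is the only lift of its label fills the whole block of a letter
  of the word. Cutting the lift there therefore cuts the word.\<close>

lemma concat_map_split:
  assumes "concat (map g w) = y @ a # z" "\<And>l. l \<in> set w \<Longrightarrow> a \<in> set (g l) \<Longrightarrow> g l = [a]"
  shows "\<exists>w1 l w2. w = w1 @ l # w2 \<and> g l = [a] \<and>
    y = concat (map g w1) \<and> z = concat (map g w2)"
  using assms
proof (induction w arbitrary: y)
  case (Cons l w)
  show ?case
  proof (cases "g l = [a] \<and> y = []")
    case True
    then show ?thesis using Cons.prems by (intro exI[of _ "[]"] exI[of _ l] exI[of _ w]) auto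
  next
    case False
    have "\<exists>y'. y = g l @ y' \<and> concat (map g w) = y' @ a # z"
    proof (cases "a \<in> set (g l)")
      case True
      then have "g l = [a]" using Cons.prems(2) by auto
      with False Cons.prems(1) show ?thesis by (cases y) auto
    next
      case a: False
      from Cons.prems(1) have "g l @ concat (map g w) = y @ a # z" by simp
      then consider us where "g l = y @ us" "us @ concat (map g w) = a # z"
        | us where "g l @ us = y" "concat (map g w) = us @ a # z"
        by (auto simp: append_eq_append_conv2)
      then show ?thesis
      proof cases
        case 1 with a show ?thesis by (cases us) auto
      qed auto
    qed
    then obtain y' where y': "y = g l @ y'" "concat (map g w) = y' @ a # z" by blast
    have "\<exists>w1 l w2. w = w1 @ l # w2 \<and> g l = [a] \<and>
        y' = concat (map g w1) \<and> z = concat (map g w2)"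
      by (rule Cons.IH[OF y'(2) Cons.prems(2)]) auto
    then obtain w1 l' w2 where
      "w = w1 @ l' # w2" "g l' = [a]" "y' = concat (map g w1)" "z = concat (map g w2)"
      by blast
    then show ?thesis using y'(1)
      by (intro exI[of _ "l # w1"] exI[of _ l'] exI[of _ w2]) simp
  qed
qed simp

lemma filter_eq_singleton:
  assumes "distinct M" "\<And>q. q \<in> set M \<and> P q \<longleftrightarrow> q = x"
  shows "filter P M = [x]"
proof -
  have "set (filter P M) = {x}" using assms(2) by auto
  moreover have "distinct (filter P M)" using assms(1) by simp
  ultimately show ?thesis
    by (cases "filter P M" rule: remdups_adj.cases) auto
qed

lemma lab_of_filter: "filter (\<lambda>q. lab q = Some v) M = [x] \<Longrightarrow> lab x = Some v"
  by (auto dest: filter_eq_ConsD)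

lemma occ_lift:
  assumes "filter (\<lambda>q. lab q = Some v) M = [x]"
  shows "occ x (lift M lab w) = occ v w"
proof (induction w)
  case (Cons l w)
  have "occ x (lift M lab [l]) = (if fst l = v then 1 else 0)"
  proof (cases "fst l = v")
    case True then show ?thesis using assms by (simp add: lift_def)
  next
    case False
    then have "x \<notin> fst ` set (lift M lab [l])"
      using lab_of_filter[OF assms] by (auto simp: lift_def)
    then show ?thesis using False occ_eq_0_iff[of x "lift M lab [l]"] by simp
  qed
  then show ?case using Cons lift_append[of M lab "[l]" w] by simp
qed (simp add: lift_def)

text \<open>If a word has fewer letters \<open>x\<close> than the lift of a reduced word \<open>w\<close>, then two consecutive
  letters \<open>v\<close> of \<open>w\<close> enclose a reduced word \<open>u\<close> whose lift commutes with \<open>x\<close>, although \<open>u\<close>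
  must contain a neighbour of \<open>v\<close>. The last hypothesis excludes this.\<close>

lemma occ_le_occ_lift:
  assumes M: "filter (\<lambda>q. lab q = Some v) M = [x]"
    and w: "reduced V E w" "gequiv V' E' (lift M lab w) w'"
    and nbr: "\<And>u k a. reduced V E u \<Longrightarrow> fst ` set u \<subseteq> fst ` set w - {v} \<Longrightarrow>
      k \<in> gwords (commutants V' E' x) \<Longrightarrow> gequiv V' E' (lift M lab u) k \<Longrightarrow>
      a \<in> fst ` set u \<Longrightarrow> {v, a} \<notin> E"
  shows "occ v w \<le> occ x w'"
proof (rule ccontr)
  assume "\<not> ?thesis"
  then have "occ x w' < occ x (lift M lab w)" using occ_lift[OF M] by simp
  from fewer_occurrences_imp_pinch[OF w(2) this] obtain y b u z k where
    dec: "lift M lab w = y @ (x, b) # u @ (x, \<not> b) # z" "occ x u = 0"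
    and k: "k \<in> gwords (commutants V' E' x)" "gequiv V' E' u k" by blast
  define g where "g l = map (\<lambda>q. (q, snd l)) (filter (\<lambda>q. lab q = Some (fst l)) M)"
    for l :: "_ \<times> bool"
  have lift_g: "lift M lab w = concat (map g w)" for w by (simp add: lift_def g_def[abs_def])
  have g: "l = (v, e)" if "(x, e) \<in> set (g l)" for l e
    using that lab_of_filter[OF M] by (auto simp: g_def prod_eq_iff)
  have g_v: "g (v, e) = [(x, e)]" for e using M by (simp add: g_def)
  have single: "g l = [(x, e)]" if "(x, e) \<in> set (g l)" for l e using g[OF that] g_v by simp
  obtain w1 l w2 where w1: "w = w1 @ l # w2" "g l = [(x, b)]"
      "u @ (x, \<not> b) # z = concat (map g w2)"
    using concat_map_split[of g w y "(x, b)"] dec(1) single[of b] lift_g[of w] by force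
  obtain w3 l' w4 where w3: "w2 = w3 @ l' # w4" "g l' = [(x, \<not> b)]" "u = concat (map g w3)"
    using concat_map_split[of g w2 u "(x, \<not> b)" z] w1(3) single[of "\<not> b"] by force
  have l: "l = (v, b)" "l' = (v, \<not> b)" using g w1(2) w3(2) by auto
  have w_eq: "w = w1 @ (v, b) # w3 @ (v, \<not> b) # w4" using w1 w3 l by simp
  have "reduced V E w3"
    using reduced_infix[of V E "w1 @ [(v, b)]" w3 "(v, \<not> b) # w4"] w(1) w_eq by simp
  \<comment> \<open>No \<open>x\<close> occurs in \<open>u\<close>, so the two letters
    \<open>v\<close> are consecutive in \<open>w\<close>.\<close>
  moreover have "v \<notin> fst ` set w3"
    using occ_lift[OF M, of w3] dec(2) w3(3) lift_g[of w3] occ_eq_0_iff[of v w3] by simp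
  then have "fst ` set w3 \<subseteq> fst ` set w - {v}" using w_eq by auto
  moreover obtain l0 where "l0 \<in> set w3" "{v, fst l0} \<in> E"
    using reduced_no_pinch[of V E w1 v b w3 w4] w(1) w_eq by blast
  ultimately show False using nbr[of w3 k "fst l0"] k w3(3) lift_g by auto
qed

section \<open>Trees of paths\<close>

text \<open>A vertex of the tree is a list \<open>u # \<dots> # [v]\<close>, the path from \<open>v\<close> to \<open>u\<close>. The centre \<open>[]\<close>
  carries the label \<open>c\<close>, if any. The word between two consecutive letters \<open>v\<close> has no letter \<open>v\<close>,
  and the neighbours of \<open>v\<close> are excluded from it one at a time, in the order of \<open>rank\<close>. So the
  subtree below a child \<open>u\<close> of \<open>v\<close> only needs to cope with words in which \<open>v\<close> and the neighbours
  of \<open>v\<close> that precede \<open>u\<close> do not occur. This makes the subtrees binomial trees at worst.\<close>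

locale path_tree =
  fixes V :: "'a set" and E :: "'a set set" and rank :: "'a \<Rightarrow> nat" and c :: "'a option"
  assumes graph: "finite_graph V E"
    and rank: "inj_on rank V"
    and centre: "c = Some a \<Longrightarrow> a \<in> V" "c = Some a \<Longrightarrow> v \<in> V \<Longrightarrow> v \<noteq> a \<Longrightarrow> {a, v} \<in> E"
begin

text \<open>The set \<open>S\<close> of the tree \<open>T(S, u)\<close> that hangs at a path with
  head \<open>u\<close>. The last clause starts every tree below the centre with all of
  \<open>V\<close>.\<close>

fun avail :: "'a list \<Rightarrow> 'a set" where
  "avail (u # v # p) = avail (v # p) - {v} - {t. {v, t} \<in> E \<and> rank t < rank u}"
| "avail p = V"

fun node :: "'a list \<Rightarrow> bool" where
  "node (u # v # p) \<longleftrightarrow> node (v # p) \<and> u \<in> avail (v # p) \<and> {v, u} \<in> E"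
| "node [v] \<longleftrightarrow> v \<in> V \<and> c \<noteq> Some v"
| "node [] \<longleftrightarrow> True"

abbreviation nodes :: "'a list set" where
  "nodes \<equiv> {p. node p}"

fun lab :: "'a list \<Rightarrow> 'a option" where
  "lab (u # p) = Some u"
| "lab [] = c"

definition edges :: "'a list set set" where
  "edges = {{p, u # p} |p u. node (u # p)}"

definition children :: "'a list \<Rightarrow> 'a set" where
  "children p = {u \<in> avail p. {hd p, u} \<in> E}"

definition subtree :: "'a list \<Rightarrow> 'a list set" where
  "subtree p = {q \<in> nodes. suffix p q}"

lemma no_loop: "{v} \<notin> E"
  using graph by (auto simp: finite_graph_def)

lemma finite_V: "finite V"
  using graph by (simp add: finite_graph_def)

lemma avail_subset_V: "avail p \<subseteq> V"
  by (induction p rule: avail.induct) auto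

lemma finite_avail: "finite (avail p)"
  using avail_subset_V finite_V finite_subset by blast

lemma avail_Cons_subset: "avail (u # p) \<subseteq> avail p"
  by (cases p) (auto simp: avail_subset_V)

lemma node_ConsD: "node (u # p) \<Longrightarrow> node p"
  by (cases p) auto

lemma hd_in_avail: "node (v # p) \<Longrightarrow> v \<in> avail (v # p)"
  using no_loop by (cases p) auto

lemma node_child: "node (v # p) \<Longrightarrow> node (u # v # p) \<longleftrightarrow> u \<in> children (v # p)"
  by (auto simp: children_def)

lemma card_avail_child:
  assumes "node (v # p)"
  shows "card (avail (u # v # p)) < card (avail (v # p))"
  using hd_in_avail[OF assms] finite_avail by (intro psubset_card_mono) auto

lemma suffix_hd_avail:
  assumes "node (s @ v # p)" "s \<noteq> []"
  shows "hd s \<in> avail (v # p) \<and> hd s \<noteq> v \<and> avail (s @ v # p) \<subseteq> avail (v # p) - {v}"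
  using assms
proof (induction s)
  case (Cons u s)
  show ?case
  proof (cases "s = []")
    case True
    with Cons.prems no_loop show ?thesis by auto
  next
    case False
    then have IH: "avail (s @ v # p) \<subseteq> avail (v # p) - {v}"
      using Cons node_ConsD by simp
    have "u \<in> avail (u # s @ v # p)" using hd_in_avail Cons.prems by simp
    with IH avail_Cons_subset[of u "s @ v # p"] show ?thesis by auto
  qed
qed simp

text \<open>\<open>v\<close> is discarded from \<open>avail\<close> at every child of the root. So
  the root is the only lift of \<open>v\<close> within its own subtree.\<close>

lemma lab_subtree:
  assumes "q \<in> subtree (v # p)" "lab q = Some v"
  shows "q = v # p"
proof -
  obtain s where s: "q = s @ v # p" "node (s @ v # p)"
    using assms(1) by (auto simp: subtree_def suffix_def)
  show ?thesis
  proof (cases s)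
    case (Cons u s')
    then show ?thesis using suffix_hd_avail[OF s(2)] s(1) assms(2) by simp
  qed (use s in simp)
qed

lemma subtree_rec:
  assumes "node (v # p)"
  shows "subtree (v # p) = insert (v # p) (\<Union>u\<in>children (v # p). subtree (u # v # p))"
proof (intro equalityI subsetI)
  fix q assume "q \<in> subtree (v # p)"
  then obtain s where s: "q = s @ v # p" "node (s @ v # p)"
    by (auto simp: subtree_def suffix_def)
  show "q \<in> insert (v # p) (\<Union>u\<in>children (v # p). subtree (u # v # p))"
  proof (cases s rule: rev_cases)
    case (snoc s' u)
    have suf: "node (t @ r) \<Longrightarrow> node r" for t r
      by (induction t) (auto dest: node_ConsD)
    have "node (u # v # p)" using s(2) snoc suf[of s' "u # v # p"] by simp
    then have "u \<in> children (v # p)" using node_child[OF assms] by simp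
    moreover have "q \<in> subtree (u # v # p)" using s snoc by (auto simp: subtree_def suffix_def)
    ultimately show ?thesis by blast
  qed (use s in simp)
next
  fix q assume "q \<in> insert (v # p) (\<Union>u\<in>children (v # p). subtree (u # v # p))"
  then show "q \<in> subtree (v # p)"
    using assms by (auto simp: subtree_def intro: suffix_ConsD)
qed

lemma nodes_rec: "nodes = insert [] (\<Union>v\<in>{v\<in>V. c \<noteq> Some v}. subtree [v])"
proof (intro equalityI subsetI)
  fix q assume "q \<in> nodes"
  then have q: "node q" by simp
  show "q \<in> insert [] (\<Union>v\<in>{v\<in>V. c \<noteq> Some v}. subtree [v])"
  proof (cases q rule: rev_cases)
    case (snoc s v)
    have suf: "node (t @ r) \<Longrightarrow> node r" for t r
      by (induction t) (auto dest: node_ConsD)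
    show ?thesis using q snoc suf[of s "[v]"] by (auto simp: subtree_def suffix_def)
  qed simp
qed (auto simp: subtree_def)

section \<open>Size of the trees\<close>

text \<open>\<open>u\<close> is available at its own path but not at that of a sibling of larger
  rank. The strict chain gives siblings available sets of distinct sizes.\<close>

lemma card_avail_mono:
  assumes "u \<in> children (v # p)" "rank u < rank u'"
  shows "card (avail (u' # v # p)) < card (avail (u # v # p))"
proof (rule psubset_card_mono)
  have "u \<in> avail (u # v # p)" "u \<notin> avail (u' # v # p)"
    using assms no_loop by (auto simp: children_def)
  then show "avail (u' # v # p) \<subset> avail (u # v # p)" using assms(2) by auto
qed (rule finite_avail)

lemma inj_on_card_avail: "inj_on (\<lambda>u. card (avail (u # v # p))) (children (v # p))"
proof (rule inj_onI)
  fix u u'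
  assume u: "u \<in> children (v # p)" "u' \<in> children (v # p)"
    "card (avail (u # v # p)) = card (avail (u' # v # p))"
  then have "rank u = rank u'"
    using card_avail_mono[of u v p u'] card_avail_mono[of u' v p u]
    by (cases "rank u" "rank u'" rule: linorder_cases) auto
  moreover have "u \<in> V" "u' \<in> V" using u avail_subset_V by (auto simp: children_def)
  ultimately show "u = u'" using rank by (auto dest: inj_onD)
qed

text \<open>Vertex count of a binomial tree: a root with subtrees of \<open>1, 2, 4, ...\<close>
  vertices. The case \<open>n = 0\<close> holds by truncated subtraction.\<close>

lemma sum_powers: "(\<Sum>i\<in>{1..<n}. 2 ^ (i - 1)) + 1 = (2 :: nat) ^ (n - 1)"
proof (induction n)
  case (Suc n)
  show ?case
  proof (cases n)
    case (Suc k)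
    have "{1..<Suc n} = insert n {1..<n}" using Suc by auto
    then show ?thesis using Suc.IH \<open>n = Suc k\<close> by simp
  qed simp
qed simp

text \<open>The available sets of the children have distinct sizes between \<open>1\<close> and
  \<open>n - 1\<close>, where \<open>n\<close> is the size at the root, so by induction a binomial
  tree bounds the subtree. An available nonneighbour of \<open>v\<close> leaves one of these sizes
  unattained, hence strictness.\<close>

lemma card_subtree:
  assumes "node (v # p)"
  shows "finite (subtree (v # p)) \<and> card (subtree (v # p)) \<le> 2 ^ (card (avail (v # p)) - 1) \<and>
    ((\<exists>a\<in>avail (v # p). a \<noteq> v \<and> {v, a} \<notin> E) \<longrightarrow>
      card (subtree (v # p)) < 2 ^ (card (avail (v # p)) - 1))"
  using assms
proof (induction "card (avail (v # p))" arbitrary: v p rule: less_induct)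
  case less
  define n where "n = card (avail (v # p))"
  define \<kappa> where "\<kappa> u = card (avail (u # v # p))" for u
  let ?C = "children (v # p)"
  have fin: "finite ?C" using finite_avail by (simp add: children_def)
  have IH: "finite (subtree (u # v # p)) \<and> card (subtree (u # v # p)) \<le> 2 ^ (\<kappa> u - 1)"
    if "u \<in> ?C" for u
    using less.hyps[of u "v # p"] card_avail_child[OF less.prems] node_child[OF less.prems] that
    by (simp add: \<kappa>_def)
  have range: "\<kappa> ` ?C \<subseteq> {1..<n}"
  proof
    fix i assume "i \<in> \<kappa> ` ?C"
    then obtain u where u: "u \<in> ?C" "i = \<kappa> u" by blast
    have "u \<in> avail (u # v # p)" using hd_in_avail node_child[OF less.prems] u(1) by metis
    then have "0 < \<kappa> u" using finite_avail[of "u # v # p"] by (auto simp: card_gt_0_iff \<kappa>_def)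
    then show "i \<in> {1..<n}"
      using u card_avail_child[OF less.prems] by (simp add: \<kappa>_def n_def)
  qed
  let ?f = "\<lambda>i. (2 :: nat) ^ (i - 1)"
  have "card (subtree (v # p)) \<le> Suc (card (\<Union>u\<in>?C. subtree (u # v # p)))"
    unfolding subtree_rec[OF less.prems] by (rule card_insert_le_m1) auto
  also have "card (\<Union>u\<in>?C. subtree (u # v # p)) \<le> (\<Sum>u\<in>?C. card (subtree (u # v # p)))"
    using fin by (rule card_UN_le)
  also have "\<dots> \<le> (\<Sum>u\<in>?C. ?f (\<kappa> u))" using IH by (intro sum_mono) simp
  also have "\<dots> = sum ?f (\<kappa> ` ?C)"
    using inj_on_card_avail by (simp add: sum.reindex \<kappa>_def[abs_def])
  finally have card: "card (subtree (v # p)) \<le> Suc (sum ?f (\<kappa> ` ?C))" by simp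
  have total: "Suc (sum ?f {1..<n}) = 2 ^ (n - 1)" using sum_powers[of n] by simp
  have le: "sum ?f (\<kappa> ` ?C) \<le> sum ?f {1..<n}" using range by (intro sum_mono2) auto
  have lt: "sum ?f (\<kappa> ` ?C) < sum ?f {1..<n}"
    if a: "a \<in> avail (v # p)" "a \<noteq> v" "{v, a} \<notin> E" for a
  proof -
    \<comment> \<open>Both \<open>v\<close> and \<open>a\<close> are missing from the children, so
      at most \<open>n - 2\<close> of the \<open>n - 1\<close> possible sizes occur.\<close>
    have "?C \<subseteq> avail (v # p) - {v} - {a}" using a no_loop by (auto simp: children_def)
    then have "card ?C \<le> card (avail (v # p) - {v} - {a})"
      using finite_avail by (intro card_mono) auto
    also have "\<dots> < card (avail (v # p) - {v})"
      using finite_avail a by (intro card_Diff1_less) auto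
    also have "\<dots> = card {1..<n}"
      using finite_avail hd_in_avail[OF less.prems] by (simp add: n_def)
    finally have "card (\<kappa> ` ?C) < card {1..<n}" using card_image_le[OF fin] le_less_trans by blast
    then have "\<kappa> ` ?C \<noteq> {1..<n}" by auto
    then obtain b where "b \<in> {1..<n} - \<kappa> ` ?C" using range by blast
    then show ?thesis using range by (intro sum_strict_mono2[of "{1..<n}" _ b]) auto
  qed
  have "finite (subtree (v # p))"
    using fin IH subtree_rec[OF less.prems] by simp
  moreover have "card (subtree (v # p)) \<le> 2 ^ (n - 1)"
    using card total le by linarith
  moreover have "card (subtree (v # p)) < 2 ^ (n - 1)"
    if "\<exists>a\<in>avail (v # p). a \<noteq> v \<and> {v, a} \<notin> E"
    using that card total lt by fastforce
  ultimately show ?case by (simp add: n_def)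
qed

lemma finite_nodes: "finite nodes"
  unfolding nodes_rec using finite_V card_subtree by auto

lemma card_nodes:
  assumes "V \<noteq> {}" "c = None \<Longrightarrow> \<forall>v\<in>V. \<exists>a\<in>V. a \<noteq> v \<and> {v, a} \<notin> E"
  shows "card nodes \<le> card V * 2 ^ (card V - 1)"
proof -
  let ?U = "{v \<in> V. c \<noteq> Some v}" and ?P = "(2 :: nat) ^ (card V - 1)"
  have "card nodes \<le> Suc (card (\<Union>v\<in>?U. subtree [v]))"
    unfolding nodes_rec by (rule card_insert_le_m1) auto
  also have "card (\<Union>v\<in>?U. subtree [v]) \<le> (\<Sum>v\<in>?U. card (subtree [v]))"
    using finite_V by (intro card_UN_le) auto
  finally have card: "card nodes \<le> Suc (\<Sum>v\<in>?U. card (subtree [v]))" by simp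
  show ?thesis
  proof (cases c)
    case None
    have "card (subtree [v]) \<le> ?P - 1" if "v \<in> V" for v
    proof -
      have "c \<noteq> Some v" using None by simp
      then have "card (subtree [v]) < ?P"
        using card_subtree[of v "[]"] assms(2)[OF None] that by simp
      then show ?thesis by linarith
    qed
    then have "(\<Sum>v\<in>V. card (subtree [v])) \<le> card V * (?P - 1)"
      using sum_bounded_above[of V "\<lambda>v. card (subtree [v])" "?P - 1"] by simp
    moreover have "?U = V" using None by simp
    \<comment> \<open>A vertex saved in one of the trees pays for the centre; this needs at least
      one tree.\<close>
    moreover have "Suc (card V * (?P - 1)) \<le> card V * ?P"
    proof -
      have "0 < card V" using assms(1) finite_V by (simp add: card_gt_0_iff)
      moreover have "card V * 1 \<le> card V * ?P" by (intro mult_le_mono) auto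
      ultimately show ?thesis unfolding diff_mult_distrib2 by linarith
    qed
    ultimately show ?thesis using card by simp
  next
    case (Some a)
    have sum: "(\<Sum>v\<in>?U. card (subtree [v])) \<le> card ?U * ?P"
      using sum_bounded_above[of ?U "\<lambda>v. card (subtree [v])" ?P] card_subtree[of _ "[]"] by auto
    have "?U = V - {a}" using Some by auto
    then have U: "card ?U = card V - 1" using centre(1)[OF Some] by simp
    have "card nodes \<le> Suc ((card V - 1) * ?P)" using card sum unfolding U by linarith
    also have "\<dots> \<le> card V * ?P"
      using assms(1) finite_V by (cases "card V") auto
    finally show ?thesis .
  qed
qed

lemma adjacent_labels:
  assumes "{p, q} \<in> edges" "lab p = Some a" "lab q = Some b"
  shows "{a, b} \<in> E"
proof -
  have "{a, b} \<in> E" if "node (u # r)" "lab r = Some a" "b = u" for u r a b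
  proof (cases r)
    case Nil
    then show ?thesis using that centre(2)[of a b] by auto
  qed (use that in auto)
  moreover obtain u r where "{p, q} = {r, u # r}" "node (u # r)"
    using assms(1) by (auto simp: edges_def)
  ultimately show ?thesis using assms(2,3) by (fastforce simp: doubleton_eq_iff insert_commute)
qed

section \<open>Lower bounds for lifts of reduced words\<close>

definition node_list :: "'a list list" where
  "node_list = (SOME N. set N = nodes \<and> distinct N)"

lemma node_list: "set node_list = nodes" "distinct node_list"
  unfolding node_list_def using someI_ex[OF finite_distinct_list[OF finite_nodes]] by auto

text \<open>Lifting along \<open>sublist p\<close> is lifting along \<open>node_list\<close>
  followed by the retraction onto the subgroup of the subtree at \<open>p\<close>.\<close>

definition sublist :: "'a list \<Rightarrow> 'a list list" where
  "sublist p = filter (\<lambda>q. q \<in> subtree p) node_list"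

text \<open>By \<open>occ_le_occ_lift\<close> it remains to exclude every neighbour \<open>a\<close>
  of \<open>v\<close> from a word \<open>u\<close> without \<open>v\<close> whose lift equals a word
  commuting with the root. This is done in the order of \<open>rank\<close>: once the smaller
  neighbours are gone, the outer induction applies to \<open>u\<close> at the child labelled
  \<open>a\<close>.\<close>

lemma occ_le_node:
  assumes "node (v # p)" "reduced V E w" "fst ` set w \<subseteq> avail (v # p)"
    and "gequiv nodes edges (lift (sublist (v # p)) lab w) w'"
  shows "occ v w \<le> occ (v # p) w'"
  using assms
proof (induction "card (avail (v # p))" arbitrary: v p w w' rule: less_induct)
  case less
  note outer_IH = less.hyps
  let ?x = "v # p"
  have "filter (\<lambda>q. lab q = Some v) (sublist ?x) = [?x]"
    using node_list less.prems(1) lab_subtree[of _ v p]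
    by (intro filter_eq_singleton) (auto simp: sublist_def subtree_def)
  then show ?case
  proof (rule occ_le_occ_lift[OF _ less.prems(2,4)])
    fix u k a
    assume u: "reduced V E u" "fst ` set u \<subseteq> fst ` set w - {v}"
      and k: "k \<in> gwords (commutants nodes edges ?x)"
        "gequiv nodes edges (lift (sublist ?x) lab u) k"
    show "a \<in> fst ` set u \<Longrightarrow> {v, a} \<notin> E"
    proof (induction "rank a" arbitrary: a rule: less_induct)
      case (less a)
      show ?case
      proof
        assume va: "{v, a} \<in> E"
        have "a \<in> avail ?x" using less.prems u(2) \<open>fst ` set w \<subseteq> avail ?x\<close> by auto
        then have node: "node (a # ?x)" using va \<open>node ?x\<close> by simp
        \<comment> \<open>\<open>less.hyps\<close> removes the neighbours of smaller rank, which are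
          exactly what \<open>avail\<close> discards at this child besides \<open>v\<close>.\<close>
        have "fst ` set u \<subseteq> avail (a # ?x)"
          using u(2) \<open>fst ` set w \<subseteq> avail ?x\<close> less.hyps by auto
        moreover have "filter (\<lambda>q. q \<in> subtree (a # ?x)) (sublist ?x) = sublist (a # ?x)"
          by (auto simp: sublist_def subtree_def intro!: filter_cong intro: suffix_ConsD)
        then have "gequiv nodes edges (lift (sublist (a # ?x)) lab u)
            (filter (\<lambda>l. fst l \<in> subtree (a # ?x)) k)"
          using gequiv_filter[OF k(2), of "subtree (a # ?x)"] by (simp add: filter_lift)
        ultimately have "occ a u \<le> occ (a # ?x) (filter (\<lambda>l. fst l \<in> subtree (a # ?x)) k)"
          by (intro outer_IH card_avail_child \<open>node ?x\<close> node u(1))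
        \<comment> \<open>The child is joined to \<open>?x\<close> by an edge, so it is not among
          the vertices that commute with \<open>?x\<close>.\<close>
        moreover have "a # ?x \<notin> fst ` set k"
          using k(1) node by (auto simp: gwords_iff commutants_def edges_def)
        ultimately have "occ a u = 0"
          using occ_filter_le[of "a # ?x" "\<lambda>l. fst l \<in> subtree (a # ?x)" k]
          by (simp add: occ_eq_0_iff[symmetric])
        then show False using less.prems by (simp add: occ_eq_0_iff)
      qed
    qed
  qed
qed

text \<open>The label of the centre may recur inside the trees. Retracting those vertices away
  leaves the centre as its only lift; the trees at the other vertices then exclude every letter from
  the enclosed word.\<close>

lemma occ_le_centre:
  assumes c: "c = Some v" and w: "reduced V E w"
    and w': "gequiv nodes edges (lift (filter (\<lambda>q. q = [] \<or> lab q \<noteq> c) node_list) lab w) w'"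
  shows "occ v w \<le> occ [] w'"
proof (rule occ_le_occ_lift[OF _ w w'])
  let ?M = "filter (\<lambda>q. q = [] \<or> lab q \<noteq> c) node_list"
  show "filter (\<lambda>q. lab q = Some v) ?M = [[]]"
    by (intro filter_eq_singleton) (auto simp: node_list c[symmetric])
  fix u k a
  assume u: "reduced V E u" "fst ` set u \<subseteq> fst ` set w - {v}"
    and k: "k \<in> gwords (commutants nodes edges [])" "gequiv nodes edges (lift ?M lab u) k"
    and a: "a \<in> fst ` set u"
  let ?T = "subtree [a]"
  have "a \<in> V" "a \<noteq> v" using u a by (auto simp: reduced_def gwords_iff)
  moreover from \<open>a \<noteq> v\<close> have "c \<noteq> Some a" using c by simp
  ultimately have node: "node [a]" by simp
  \<comment> \<open>\<open>u\<close> has no letter \<open>v\<close>, so removing the vertices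
    labelled \<open>v\<close> from the tree does not affect its lift.\<close>
  have "lift (filter (\<lambda>q. q \<in> ?T) ?M) lab u = lift (sublist [a]) lab u"
  proof (rule lift_cong)
    fix l assume "l \<in> set u"
    then have "c \<noteq> Some (fst l)" using u(2) c by auto
    then show "filter (\<lambda>q. lab q = Some (fst l)) (filter (\<lambda>q. q \<in> ?T) ?M) =
        filter (\<lambda>q. lab q = Some (fst l)) (sublist [a])"
      by (auto simp: sublist_def subtree_def intro!: filter_cong)
  qed
  then have "gequiv nodes edges (lift (sublist [a]) lab u) (filter (\<lambda>l. fst l \<in> ?T) k)"
    using gequiv_filter[OF k(2), of ?T] by (simp add: filter_lift)
  from occ_le_node[OF node u(1) _ this]
  have "occ a u \<le> occ [a] (filter (\<lambda>l. fst l \<in> ?T) k)"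
    using u(1) by (simp add: reduced_def gwords_iff)
  moreover have "[a] \<notin> fst ` set k"
    using k(1) node by (auto simp: gwords_iff commutants_def edges_def)
  ultimately have "occ a u = 0"
    using occ_filter_le[of "[a]" "\<lambda>l. fst l \<in> ?T" k] by (simp add: occ_eq_0_iff[symmetric])
  then show "{v, a} \<notin> E" using a by (simp add: occ_eq_0_iff)
qed

text \<open>Distinct generators are counted at distinct top vertices, so the bounds for the single
  generators add up.\<close>

lemma length_le_lift:
  assumes w: "reduced V E w" and w': "gequiv nodes edges (lift node_list lab w) w'"
  shows "length w \<le> length w'"
proof -
  define top where "top v = (if c = Some v then [] else [v])" for v
  have "occ v w \<le> occ (top v) w'" if "v \<in> V" for v
  proof (cases "c = Some v")
    case True
    let ?R = "{q. q = [] \<or> lab q \<noteq> c}"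
    have "occ v w \<le> occ [] (filter (\<lambda>l. fst l \<in> ?R) w')"
      using gequiv_filter[OF w', of ?R] unfolding filter_lift
      by (intro occ_le_centre[OF True w]) simp
    also have "\<dots> \<le> occ [] w'" by (rule occ_filter_le)
    finally show ?thesis using True by (simp add: top_def)
  next
    case False
    let ?R = "subtree [v]"
    have "occ v w \<le> occ [v] (filter (\<lambda>l. fst l \<in> ?R) w')"
      using gequiv_filter[OF w', of ?R] w False that
      by (intro occ_le_node) (auto simp: filter_lift sublist_def reduced_def gwords_iff)
    also have "\<dots> \<le> occ [v] w'" by (rule occ_filter_le)
    finally show ?thesis using False by (simp add: top_def)
  qed
  then have "(\<Sum>v\<in>V. occ v w) \<le> (\<Sum>v\<in>V. occ (top v) w')" by (intro sum_mono)
  also have "\<dots> = (\<Sum>x\<in>top ` V. occ x w')"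
    by (subst sum.reindex) (auto simp: inj_on_def top_def split: if_splits)
  also have "\<dots> \<le> length w'" using finite_V by (intro sum_occ_le) simp
  finally show ?thesis using sum_occ[OF finite_V, of w] w by (simp add: reduced_def)
qed

end

section \<open>Finite trees from parent maps\<close>

lemma is_walk_iff:
  "is_walk V E p \<longleftrightarrow> p \<noteq> [] \<and> set p \<subseteq> V \<and> successively (adjacent E) p"
  by (auto simp: is_walk_def successively_conv_nth)

lemma adjacent_commute: "adjacent E u v \<longleftrightarrow> adjacent E v u"
  by (simp add: adjacent_def insert_commute)

locale parent_tree =
  fixes X :: "'b set" and r :: 'b and par :: "'b \<Rightarrow> 'b" and depth :: "'b \<Rightarrow> nat"
    and F :: "'b set set"
  assumes finite: "finite X" and root: "r \<in> X"
    and par: "x \<in> X \<Longrightarrow> x \<noteq> r \<Longrightarrow> par x \<in> X \<and> depth (par x) < depth x"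
    and F: "F = {{x, par x} |x. x \<in> X \<and> x \<noteq> r}"
begin

lemma walk_to_root: "x \<in> X \<Longrightarrow> \<exists>p. is_walk X F p \<and> hd p = x \<and> last p = r"
proof (induction "depth x" arbitrary: x rule: less_induct)
  case less
  show ?case
  proof (cases "x = r")
    case True
    then show ?thesis using root by (intro exI[of _ "[r]"]) (simp add: is_walk_iff)
  next
    case False
    then obtain p where p: "is_walk X F p" "hd p = par x" "last p = r"
      using less par by blast
    have "adjacent F x (par x)" using False less.prems F by (auto simp: adjacent_def)
    with p less.prems have "is_walk X F (x # p)" by (auto simp: is_walk_iff successively_Cons)
    then show ?thesis using p by (intro exI[of _ "x # p"]) (auto simp: is_walk_iff)
  qed
qed

lemma connected: "connected_graph X F"
  unfolding connected_graph_def
proof (intro ballI)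
  fix u v assume "u \<in> X" "v \<in> X"
  then obtain p q where p: "is_walk X F p" "hd p = u" "last p = r"
    and q: "is_walk X F q" "hd q = v" "last q = r" using walk_to_root by metis
  have ne: "p \<noteq> []" "q \<noteq> []" using p q by (auto simp: is_walk_iff)
  have rev: "successively (adjacent F) (rev q)"
    using q(1) by (simp add: is_walk_iff successively_rev adjacent_commute)
  obtain t where t: "rev q = r # t"
    using ne q(3) by (metis hd_rev list.collapse rev_is_Nil_conv)
  have "set t \<subseteq> set (rev q)" unfolding t by auto
  then have "set t \<subseteq> X" using q(1) by (auto simp: is_walk_iff)
  then have "is_walk X F (p @ t)"
    using p(1,3) rev ne unfolding t
    by (auto simp: is_walk_iff successively_append_iff successively_Cons)
  moreover have "last (p @ t) = v"
    using q(2) t p(3) ne by (metis last_ConsL last_ConsR last_append last_rev append_Nil2)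
  ultimately show "\<exists>p. is_walk X F p \<and> hd p = u \<and> last p = v"
    using p(2) ne by (intro exI[of _ "p @ t"]) simp
qed

lemma adjacent_depth:
  assumes "adjacent F u v" "depth v \<le> depth u"
  shows "v = par u"
  using assms par F by (force simp: adjacent_def doubleton_eq_iff)

text \<open>Both neighbours on a cycle of a vertex of maximal depth would be its parent.\<close>

lemma acyclic: "acyclic_graph X F"
  unfolding acyclic_graph_def
proof
  assume "\<exists>c. is_cycle X F c"
  then obtain c where c: "length c \<ge> 3" "distinct c" "is_walk X F c" "adjacent F (last c) (hd c)"
    by (auto simp: is_cycle_def)
  define n where "n = length c"
  have n: "n \<ge> 3" using c(1) by (simp add: n_def)
  have step: "adjacent F (c ! k) (c ! (Suc k mod n))" if "k < n" for k
  proof (cases "Suc k = n")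
    case True
    have "c \<noteq> []" using n by (auto simp: n_def)
    moreover have "k = length c - 1" using True by (simp add: n_def)
    ultimately have "last c = c ! k" "hd c = c ! 0"
      by (simp_all add: last_conv_nth hd_conv_nth)
    then show ?thesis using c(4) True by simp
  next
    case False
    then show ?thesis using c(3) that by (simp add: is_walk_def n_def)
  qed
  define D where "D = (\<lambda>k. depth (c ! k)) ` {..<n}"
  have D: "finite D" "D \<noteq> {}" using n by (auto simp: D_def lessThan_empty_iff)
  then have "Max D \<in> D" by (rule Max_in)
  then obtain i where i: "i < n" "Max D = depth (c ! i)" by (auto simp: D_def)
  have max: "depth (c ! k) \<le> depth (c ! i)" if "k < n" for k
    unfolding i(2)[symmetric] using D(1) that by (intro Max_ge) (auto simp: D_def)
  define j where "j = (if i = 0 then n - 1 else i - 1)"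
  have j: "j < n" "Suc j mod n = i" using i(1) n by (auto simp: j_def)
  have "c ! (Suc i mod n) = par (c ! i)"
    using step[OF i(1)] max[of "Suc i mod n"] n by (intro adjacent_depth) auto
  moreover have "c ! j = par (c ! i)"
    using step[OF j(1)] max[OF j(1)] j(2) by (intro adjacent_depth) (auto simp: adjacent_commute)
  ultimately have "Suc i mod n = j"
    using nth_eq_iff_index_eq[OF c(2), of "Suc i mod n" j] j(1) n by (simp add: n_def[symmetric])
  \<comment> \<open>The cyclic successor and predecessor of \<open>i\<close> coincide, which a
    length of at least three forbids.\<close>
  then show False using i(1) n by (cases "Suc i = n") (auto simp: j_def split: if_splits)
qed

lemma finite_tree: "finite_tree X F"
proof -
  have "\<forall>e\<in>F. e \<subseteq> X \<and> card e = 2"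
    using par F by (fastforce simp: card_2_iff)
  then show ?thesis
    using finite root connected acyclic by (auto simp: finite_tree_def finite_graph_def)
qed

end

section \<open>Homomorphisms and word metrics from words\<close>

lemma equiv_grel: "equiv (gwords V) (grel V E)"
proof (rule equivI)
  show "grel V E \<subseteq> gwords V \<times> gwords V" by (auto simp: grel_def dest: gequiv_gwords)
  show "refl_on (gwords V) (grel V E)" by (auto simp: refl_on_def grel_def intro: gequiv.refl)
  show "sym (grel V E)" by (auto simp: sym_def grel_def gequiv.sym)
  show "trans (grel V E)"
    unfolding trans_def grel_def using gequiv.trans by fast
qed

lemma gclass_eq_iff:
  assumes "u \<in> gwords V" "w \<in> gwords V"
  shows "gclass V E u = gclass V E w \<longleftrightarrow> gequiv V E u w"
  using eq_equiv_class_iff[OF equiv_grel assms] by (simp add: gclass_def grel_def)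

lemma carrier_G: "carrier (G V E) = gclass V E ` gwords V"
  by (auto simp: G_def quotient_def gclass_def)

lemma gequiv_some:
  assumes "w \<in> gwords V"
  shows "gequiv V E w (SOME x. x \<in> gclass V E w)"
proof -
  have "w \<in> gclass V E w" using assms by (simp add: gclass_def grel_def gequiv.refl)
  then have "(SOME x. x \<in> gclass V E w) \<in> gclass V E w" by (rule someI)
  then show ?thesis by (simp add: gclass_def grel_def)
qed

lemma mult_gclass:
  assumes "u \<in> gwords V" "w \<in> gwords V"
  shows "gclass V E u \<otimes>\<^bsub>G V E\<^esub> gclass V E w = gclass V E (u @ w)"
proof -
  have "gequiv V E (u @ w) ((SOME x. x \<in> gclass V E u) @ (SOME x. x \<in> gclass V E w))"
    by (intro gequiv_append gequiv_some assms)
  from gclass_eq_iff[THEN iffD2, OF _ _ this] gequiv_gwords[OF this] show ?thesis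
    by (simp add: G_def)
qed

lemma word_dist_gclass:
  assumes "u \<in> gwords V" "w \<in> gwords V"
  shows "\<exists>z. reduced V E z \<and> gequiv V E (u @ z) w \<and>
    word_dist V E (gclass V E u) (gclass V E w) = length z"
proof -
  let ?P = "\<lambda>n. \<exists>z\<in>gwords V. length z = n \<and>
    gclass V E u \<otimes>\<^bsub>G V E\<^esub> gclass V E z = gclass V E w"
  have P_iff: "?P n \<longleftrightarrow> (\<exists>z\<in>gwords V. length z = n \<and> gequiv V E (u @ z) w)" for n
    using assms by (intro bex_cong) (auto simp: mult_gclass gclass_eq_iff)
  \<comment> \<open>Some connecting word exists, so \<open>LEAST\<close> is attained.\<close>
  have "gequiv V E (u @ winv u @ w) w"
    using gequiv_append_right[OF gequiv_winv_right[OF assms(1), of E] assms(2)] by simp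
  then have "?P (length (winv u @ w))"
    unfolding P_iff using assms by (intro bexI[of _ "winv u @ w"]) auto
  then have least: "?P (LEAST n. ?P n)" by (rule LeastI)
  define d where "d = word_dist V E (gclass V E u) (gclass V E w)"
  have "d = (LEAST n. ?P n)" by (simp add: d_def word_dist_def)
  with least have "?P d" by simp
  then obtain z where z: "z \<in> gwords V" "length z = d" "gequiv V E (u @ z) w"
    unfolding P_iff by blast
  have "length z \<le> length z'" if "gequiv V E z z'" for z'
  proof -
    have "gequiv V E (u @ z') w"
      using gequiv.trans[OF gequiv.sym[OF gequiv_append_left[OF that assms(1)]] z(3)] .
    then have "?P (length z')" unfolding P_iff using gequiv_gwords[OF that] by blast
    then have "(LEAST n. ?P n) \<le> length z'" by (rule Least_le)
    then show ?thesis using z(2) \<open>d = (LEAST n. ?P n)\<close> by simp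
  qed
  then show ?thesis using z by (auto simp: reduced_def d_def)
qed

lemma word_dist_le:
  assumes "u \<in> gwords V" "z \<in> gwords V" "gequiv V E (u @ z) w"
  shows "word_dist V E (gclass V E u) (gclass V E w) \<le> length z"
proof -
  have "w \<in> gwords V" using gequiv_gwords[OF assms(3)] by blast
  then have "gclass V E u \<otimes>\<^bsub>G V E\<^esub> gclass V E z = gclass V E w"
    using assms by (simp add: mult_gclass gclass_eq_iff)
  then show ?thesis using assms(2) unfolding word_dist_def by (intro Least_le) blast
qed

text \<open>\<open>lower\<close> says that geodesic words do not get shorter in the target. So
  distances never decrease, which yields both injectivity and the lower bound.\<close>

lemma qi_group_embedding_words:
  assumes words: "\<And>w. w \<in> gwords V \<Longrightarrow> \<phi> w \<in> gwords V'"
    and append: "\<And>u w. \<phi> (u @ w) = \<phi> u @ \<phi> w"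
    and equiv: "\<And>u w. gequiv V E u w \<Longrightarrow> gequiv V' E' (\<phi> u) (\<phi> w)"
    and upper: "\<And>w. length (\<phi> w) \<le> M * length w"
    and lower: "\<And>w w'. reduced V E w \<Longrightarrow> gequiv V' E' (\<phi> w) w' \<Longrightarrow> length w \<le> length w'"
  shows "\<exists>f. qi_group_embedding V E V' E' f"
proof -
  define f where "f X = gclass V' E' (\<phi> (SOME x. x \<in> X))" for X
  have f: "f (gclass V E w) = gclass V' E' (\<phi> w)" if "w \<in> gwords V" for w
    using equiv[OF gequiv.sym[OF gequiv_some[OF that, of E]]]
    by (simp add: f_def gclass_eq_iff gequiv_gwords)
  have dist: "word_dist V E (gclass V E u) (gclass V E w) \<le>
        word_dist V' E' (gclass V' E' (\<phi> u)) (gclass V' E' (\<phi> w)) \<and>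
      word_dist V' E' (gclass V' E' (\<phi> u)) (gclass V' E' (\<phi> w)) \<le>
        M * word_dist V E (gclass V E u) (gclass V E w)"
    (is "?d \<le> ?d' \<and> _") if uw: "u \<in> gwords V" "w \<in> gwords V" for u w
  proof -
    obtain z where z: "reduced V E z" "gequiv V E (u @ z) w" "?d = length z"
      using word_dist_gclass[OF uw] by blast
    obtain z' where z': "gequiv V' E' (\<phi> u @ z') (\<phi> w)" "?d' = length z'"
      using word_dist_gclass[OF words[OF uw(1)] words[OF uw(2)]] by blast
    have \<phi>z: "gequiv V' E' (\<phi> u @ \<phi> z) (\<phi> w)" using equiv[OF z(2)] by (simp add: append)
    have "gequiv V' E' (\<phi> u @ \<phi> z) (\<phi> u @ z')"
      using gequiv.trans[OF \<phi>z gequiv.sym[OF z'(1)]] .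
    then have "?d \<le> ?d'" using lower[OF z(1) gequiv_left_cancel] z(3) z'(2) by simp
    moreover have "?d' \<le> length (\<phi> z)"
      using word_dist_le[OF _ _ \<phi>z] words uw z(1) by (simp add: reduced_def)
    ultimately show ?thesis using upper[of z] z(3) by simp
  qed
  have "f \<in> hom (G V E) (G V' E')"
  proof (rule homI)
    fix x y assume "x \<in> carrier (G V E)" "y \<in> carrier (G V E)"
    then show "f (x \<otimes>\<^bsub>G V E\<^esub> y) = f x \<otimes>\<^bsub>G V' E'\<^esub> f y"
      by (auto simp: carrier_G f mult_gclass words append)
  qed (auto simp: carrier_G f words)
  moreover have "inj_on f (carrier (G V E))"
  proof (rule inj_onI)
    fix x y assume "x \<in> carrier (G V E)" "y \<in> carrier (G V E)" and eq: "f x = f y"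
    then obtain u w where uw: "u \<in> gwords V" "w \<in> gwords V" "x = gclass V E u" "y = gclass V E w"
      by (auto simp: carrier_G)
    have "gequiv V' E' (\<phi> u @ []) (\<phi> w)"
      using eq uw by (simp add: f words gclass_eq_iff)
    then have "word_dist V' E' (gclass V' E' (\<phi> u)) (gclass V' E' (\<phi> w)) = 0"
      using word_dist_le[of "\<phi> u" V' "[]" E'] words uw(1) by fastforce
    then have "word_dist V E x y = 0" using dist[OF uw(1,2)] uw(3,4) by simp
    then have "gequiv V E u w" using word_dist_gclass[OF uw(1,2), of E] uw(3,4) by fastforce
    then show "x = y" using uw by (simp add: gclass_eq_iff)
  qed
  moreover have "\<exists>C::real. C \<ge> 1 \<and> (\<forall>x \<in> carrier (G V E). \<forall>y \<in> carrier (G V E).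
      real (word_dist V E x y) / C - C \<le> real (word_dist V' E' (f x) (f y)) \<and>
      real (word_dist V' E' (f x) (f y)) \<le> C * real (word_dist V E x y) + C)"
  \<comment> \<open>\<open>Suc M\<close> rather than \<open>M\<close>, as \<open>M\<close> may be
    \<open>0\<close> while the constant must be at least one.\<close>
  proof (intro exI[of _ "real (Suc M)"] conjI ballI)
    fix x y assume "x \<in> carrier (G V E)" "y \<in> carrier (G V E)"
    then obtain u w where uw: "u \<in> gwords V" "w \<in> gwords V" "x = gclass V E u" "y = gclass V E w"
      by (auto simp: carrier_G)
    let ?d = "word_dist V E x y" and ?d' = "word_dist V' E' (f x) (f y)"
    have d: "?d \<le> ?d'" "?d' \<le> M * ?d" using dist[OF uw(1,2)] uw by (auto simp: f)
    have "real ?d / real (Suc M) \<le> real ?d / 1" by (intro divide_left_mono) auto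
    then show "real ?d / real (Suc M) - real (Suc M) \<le> real ?d'" using d(1) by simp
    have "real ?d' \<le> real M * real ?d" using d(2) by (metis of_nat_le_iff of_nat_mult)
    also have "\<dots> \<le> real (Suc M) * real ?d" by (intro mult_right_mono) auto
    finally show "real ?d' \<le> real (Suc M) * real ?d + real (Suc M)" by simp
  qed simp
  ultimately show ?thesis unfolding qi_group_embedding_def by blast
qed

section \<open>Renaming vertices by natural numbers\<close>

text \<open>Injectivity on \<open>V\<close>, which contains all edges, keeps the image of a nonedge
  from being an edge.\<close>

lemma gequiv_relabel:
  assumes "gequiv V E w w'" "inj_on e V" "\<forall>x\<in>E. x \<subseteq> V"
  shows "gequiv (e ` V) ((`) e ` E) (map (apfst e) w) (map (apfst e) w')"
proof -
  have words: "map (apfst e) w \<in> gwords (e ` V)" if "w \<in> gwords V" for w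
    using that by (auto simp: gwords_iff)
  from assms(1) show ?thesis
  proof (induction rule: gequiv.induct)
    case (refl w) then show ?case by (intro gequiv.refl words)
  next
    case (sym w w') then show ?case by (blast intro: gequiv.sym)
  next
    case (trans w w' w'') then show ?case by (blast intro: gequiv.trans)
  next
    case (cancel xs ys v b)
    then show ?case by (auto intro!: gequiv.cancel words)
  next
    case (commute xs ys u v b c)
    have "{e u, e v} \<notin> (`) e ` E"
    proof
      assume "{e u, e v} \<in> (`) e ` E"
      then obtain x where x: "x \<in> E" "e ` {u, v} = e ` x" by auto
      then have "{u, v} = x"
        using inj_on_image_eq_iff[OF assms(2), of "{u, v}" x] assms(3) commute(3,4) by auto
      then show False using x(1) commute(5) by simp
    qed
    then show ?case using commute by (auto intro!: gequiv.commute words)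
  qed
qed

lemma gequiv_relabel_inv:
  assumes "gequiv (e ` V) ((`) e ` E) (map (apfst e) w) w'" "w \<in> gwords V"
    and "inj_on e V" "\<forall>x\<in>E. x \<subseteq> V"
  shows "gequiv V E w (map (apfst (inv_into V e)) w')"
proof -
  let ?d = "inv_into V e"
  have sets: "?d ` e ` x = x" if "x \<subseteq> V" for x
    using that assms(3) by (rule inv_into_image_cancel[rotated])
  have "(`) ?d ` (`) e ` E = E" using assms(4) sets by (force simp: image_image)
  moreover have "\<forall>x\<in>(`) e ` E. x \<subseteq> e ` V" using assms(4) by blast
  moreover have "map (apfst ?d) (map (apfst e) w) = w"
    using assms(2,3) unfolding map_map by (intro map_idI) (auto simp: gwords_iff)
  ultimately show ?thesis
    using gequiv_relabel[OF assms(1), of ?d] inj_on_inv_into[of "e ` V" e V] sets[of V]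
    by simp
qed

theorem theorem3p12:
  fixes V :: "'a set" and E :: "'a set set"
  assumes "finite_graph V E" and "V \<noteq> {}"
  shows "\<exists>(VT :: nat set) ET f. finite_tree VT ET \<and>
           card VT \<le> card V * 2 ^ (card V - 1) \<and>
           qi_group_embedding V E VT ET f"
proof -
  let ?dominating = "\<lambda>a. a \<in> V \<and> (\<forall>v\<in>V. v \<noteq> a \<longrightarrow> {a, v} \<in> E)"
  \<comment> \<open>A vertex adjacent to all others labels the centre. If none exists, every vertex
    has a nonneighbour other than itself, as \<open>card_nodes\<close> requires.\<close>
  define c where "c = (if \<exists>a. ?dominating a then Some (SOME a. ?dominating a) else None)"
  have c: "?dominating a" if "c = Some a" for a
    using that someI_ex[of ?dominating] by (auto simp: c_def split: if_splits)
  have "finite V" using assms(1) by (simp add: finite_graph_def)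
  then obtain rank :: "'a \<Rightarrow> nat" where rank: "inj_on rank V"
    using finite_imp_inj_to_nat_seg by blast
  interpret path_tree V E rank c
    using assms(1) rank c by unfold_locales auto
  have card: "card nodes \<le> card V * 2 ^ (card V - 1)"
    using assms(2) by (rule card_nodes) (auto simp: c_def split: if_splits)
  obtain e :: "'a list \<Rightarrow> nat" where e: "inj_on e nodes"
    using finite_imp_inj_to_nat_seg[OF finite_nodes] by blast
  define d where "d = inv_into nodes e"
  have d: "d (e q) = q" if "node q" for q using that e by (simp add: d_def)
  have edges_nodes: "\<forall>x\<in>edges. x \<subseteq> nodes"
    by (auto simp: edges_def dest: node_ConsD)
  let ?X = "e ` nodes" and ?F = "(`) e ` edges"
  have "finite_tree ?X ?F"
  proof (rule parent_tree.finite_tree)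
    \<comment> \<open>The parent of a path drops its last step, which is the head of the list; the
      depth is the length.\<close>
    show "parent_tree ?X (e []) (\<lambda>x. e (tl (d x))) (\<lambda>x. length (d x)) ?F"
    proof
      show "finite ?X" using finite_nodes by simp
      show "e [] \<in> ?X" by simp
      fix x assume "x \<in> ?X" "x \<noteq> e []"
      then obtain u q where q: "x = e (u # q)" "node (u # q)"
        by (auto simp: neq_Nil_conv) (metis list.exhaust)
      then show "e (tl (d x)) \<in> ?X \<and> length (d (e (tl (d x)))) < length (d x)"
        using node_ConsD[OF q(2)] by (auto simp: d)
    next
      show "?F = {{x, e (tl (d x))} |x. x \<in> ?X \<and> x \<noteq> e []}"
      proof (intro equalityI subsetI)
        fix y assume "y \<in> ?F"
        then obtain u q where q: "y = {e q, e (u # q)}" "node (u # q)"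
          by (auto simp: edges_def)
        moreover have "e (u # q) \<noteq> e []" using q(2) e by (auto dest: inj_onD)
        ultimately show "y \<in> {{x, e (tl (d x))} |x. x \<in> ?X \<and> x \<noteq> e []}"
          by (intro CollectI exI[of _ "e (u # q)"]) (auto simp: d)
      next
        fix y assume "y \<in> {{x, e (tl (d x))} |x. x \<in> ?X \<and> x \<noteq> e []}"
        then obtain p where p: "node p" "p \<noteq> []" "y = {e p, e (tl (d (e p)))}" by auto
        then obtain u q where "p = u # q" by (cases p) auto
        with p show "y \<in> ?F" by (auto simp: edges_def d intro!: image_eqI[of _ _ "{q, u # q}"])
      qed
    qed
  qed
  moreover have "card ?X \<le> card V * 2 ^ (card V - 1)" using card e by (simp add: card_image)
  moreover have "\<exists>f. qi_group_embedding V E ?X ?F f"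
  proof (rule qi_group_embedding_words)
    let ?\<phi> = "\<lambda>w. map (apfst e) (lift node_list lab w)"
    have lift: "lift node_list lab w \<in> gwords nodes" for w
      using node_list by (intro lift_gwords) simp
    show "?\<phi> w \<in> gwords ?X" for w
      using lift[of w] by (auto simp: gwords_iff)
    show "?\<phi> (u @ w) = ?\<phi> u @ ?\<phi> w" for u w by (simp add: lift_append)
    show "gequiv ?X ?F (?\<phi> u) (?\<phi> w)" if "gequiv V E u w" for u w
      by (rule gequiv_relabel[OF gequiv_lift[OF that] e edges_nodes])
        (auto simp: node_list no_loop intro: adjacent_labels)
    show "length (?\<phi> w) \<le> length node_list * length w" for w by (simp add: length_lift)
    show "length w \<le> length w'" if "reduced V E w" "gequiv ?X ?F (?\<phi> w) w'" for w w'
      using length_le_lift[OF that(1) gequiv_relabel_inv[OF that(2) lift e edges_nodes]] by simp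
  qed
  ultimately show ?thesis by blast
qed

end
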